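(* For every integer $m\ge1$, $$I_{0^+}^m\log\Gamma(1)=\int_{0}^{1}\int_{0}^{t_1}\cdots\int_{0}^{t_{m-1}}\log\Gamma(t_m)\,dt_m\cdots dt_2\,dt_1=\frac{1}{m!}\sum_{k=0}^{m-1}\binom{m}{k}\log D_k=\sum_{k=0}^{m-1}\frac{\log D_k}{k!(m-k)!}.$$
   Context: $\Gamma$ is Euler's gamma function and $\log\Gamma(t)$ is the real logarithm for $t\in(0,1]$. The left-sided Riemann-Liouville fractional integral of order $\alpha$ ($\mathfrak{Re}(\alpha)>0$) of $f$ on $[a,b]$ is $I_{a^+}^\alpha f(x)=\frac{1}{\Gamma(\alpha)}\int_a^x (x-t)^{\alpha-1}f(t)\,dt$ for $a<x\le b$; here $a=0$, $b=x=1$, so $I_{0^+}^m\log\Gamma(1)=\frac{1}{(m-1)!}\int_0^1(1-t)^{m-1}\log\Gamma(t)\,dt$. For $m=1$ the repeated integral is $\int_0^1\log\Gamma(t_1)\,dt_1$. Generalized Glaisher constants $D_k>0$, $k=0,1,2,\dots$, are defined by $$\log D_k=\lim_{n\to\infty}\Big(\sum_{m=1}^n m^k\log m-p(n,k)\Big),$$ $$p(n,k)=\frac{n^k\log n}{2}+\frac{n^{k+1}}{k+1}\Big(\log n-\frac{1}{k+1}\Big)+k!\sum_{m=1}^{k}\frac{n^{k-m}B_{m+1}}{(m+1)!(k-m)!}\Big(\log n+(1-\delta_{km})\sum_{l=1}^{m}\frac{1}{k-l+1}\Big)$$ (in these two formulas $m$ is a summation index), where $\delta_{km}$ is the Kronecker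 delta, empty sums are $0$, and $B_j$ are the Bernoulli numbers given by $\frac{t}{e^t-1}=\sum_{j\ge0}B_j\frac{t^j}{j!}$ for $|t|<2\pi$. *)

theory Defs
  imports "HOL-Complex_Analysis.Complex_Analysis"
begin

text \<open>Complex orders are allowed. Since \<open>0 powr z = 0\<close>, the value of the kernel
  at the single point \<open>t = x\<close> is a convention; it does not affect the integral.\<close>

definition rl_integral :: "real \<Rightarrow> complex \<Rightarrow> (real \<Rightarrow> complex) \<Rightarrow> real \<Rightarrow> complex" where
  "rl_integral a \<alpha> f x =
     1 / Gamma \<alpha> * integral {a..x} (\<lambda>t. complex_of_real (x - t) powr (\<alpha> - 1) * f t)"

text \<open>\<open>iterated_integral a m f x\<close> is the integral of \<open>f t\<^sub>m\<close> over
  \<open>a \<le> t\<^sub>m \<le> \<dots> \<le> t\<^sub>1 \<le> x\<close>, integrated successively in \<open>t\<^sub>m, \<dots>, t\<^sub>1\<close>.\<close>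

primrec iterated_integral :: "real \<Rightarrow> nat \<Rightarrow> (real \<Rightarrow> real) \<Rightarrow> real \<Rightarrow> real" where
  "iterated_integral a 0 f x = f x"
| "iterated_integral a (Suc m) f x = integral {a..x} (\<lambda>t. iterated_integral a m f t)"

text \<open>The Bernoulli numbers with \<open>B\<^sub>1 = -1/2\<close>. The quotient is taken in the ring of formal
  power series, where dividing two series of order 1 is exact; the lemma
  \<open>bernoulli_number_sums\<close> gives the analytic form of the generating function.\<close>

definition bernoulli_number :: "nat \<Rightarrow> real" where
  "bernoulli_number j = fact j * fps_nth (fps_X / (fps_exp 1 - 1)) j"

lemma bernoulli_number_sums:
  fixes t :: complex
  assumes "norm t < 2 * pi"
  shows "(\<lambda>j. of_real (bernoulli_number j) * t ^ j / fact j) sums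
           (if t = 0 then 1 else t / (exp t - 1))"
proof -
  define G :: "complex fps" where "G = fps_exp 1 - 1"
  define R :: "real fps" where "R = fps_X / (fps_exp 1 - 1)"
  define F :: "complex fps" where "F = Abs_fps (\<lambda>j. of_real (fps_nth R j))"
  have subdeg: "subdegree (fps_exp 1 - 1 :: complex fps) = 1"
    by (rule subdegreeI) auto
  have subdeg_real: "subdegree (fps_exp 1 - 1 :: real fps) = 1"
    by (rule subdegreeI) auto
  have G_nz: "G \<noteq> 0"
    using subdeg unfolding G_def by (metis subdegree_0 zero_neq_one)
  have "(fps_exp 1 - 1 :: real fps) dvd fps_X"
  proof (subst fps_dvd_iff)
    show "(fps_exp 1 - 1 :: real fps) \<noteq> 0"
      using subdeg_real by (metis subdegree_0 zero_neq_one)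
  qed (use subdeg_real in auto)
  then have R: "R * (fps_exp 1 - 1) = fps_X"
    unfolding R_def by simp
  have "F * G = fps_X"
  proof (rule fps_ext)
    fix n
    have "fps_nth (F * G) n = of_real (fps_nth (R * (fps_exp 1 - 1)) n)"
      unfolding fps_mult_nth F_def G_def
      by (auto simp: of_real_sum intro!: sum.cong)
    also have "\<dots> = fps_nth fps_X n"
      unfolding R by simp
    finally show "fps_nth (F * G) n = fps_nth fps_X n" .
  qed
  then have F: "F = fps_X / G"
    using G_nz by (metis nonzero_mult_div_cancel_right)
  have eval_G: "eval_fps G z = exp z - 1" for z
    unfolding G_def by (simp add: eval_fps_diff)
  have nz: "eval_fps G z \<noteq> 0" if "z \<in> eball 0 (ereal (2 * pi))" "z \<noteq> 0" for z
  proof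
    assume "eval_fps G z = 0"
    then have "exp z = 1" by (simp add: eval_G)
    then obtain n :: int where n: "Re z = 0" "Im z = of_int (2 * n) * pi"
      by (auto simp: exp_eq_1)
    with that have "n \<noteq> 0" by (auto simp: complex_eq_iff)
    then have "1 \<le> \<bar>real_of_int n\<bar>" by linarith
    then have "2 * pi \<le> \<bar>Im z\<bar>" by (simp add: n abs_mult)
    also have "\<dots> \<le> norm z" by (rule abs_Im_le_cmod)
    finally show False using that by simp
  qed
  have rad_G: "fps_conv_radius G = \<infinity>"
  proof -
    have "fps_conv_radius G \<ge> min (fps_conv_radius (fps_exp (1::complex))) (fps_conv_radius 1)"
      unfolding G_def using fps_conv_radius_diff[of "fps_exp (1::complex)" 1] by simp
    then show ?thesis by simp
  qed
  have less: "ereal (norm t) < Min {ereal (2 * pi), fps_conv_radius (fps_X :: complex fps), fps_conv_radius G}"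
    using assms by (simp add: rad_G)
  have prem: "subdegree G \<le> subdegree (fps_X :: complex fps)"
    "0 < fps_conv_radius (fps_X :: complex fps)" "0 < fps_conv_radius G" "0 < ereal (2 * pi)"
    using subdeg by (auto simp: G_def[symmetric] rad_G)
  have "fps_conv_radius F \<ge> Min {ereal (2 * pi), fps_conv_radius (fps_X :: complex fps), fps_conv_radius G}"
    unfolding F by (rule fps_conv_radius_divide[OF prem nz])
  then have "ereal (norm t) < fps_conv_radius F"
    using less by (rule less_le_trans[rotated])
  then have "(\<lambda>j. fps_nth F j * t ^ j) sums eval_fps F t"
    by (rule sums_eval_fps)
  moreover have "eval_fps F t = (if t = 0 then 1 else eval_fps fps_X t / eval_fps G t)"
    unfolding F
    by (rule eval_fps_divide[OF prem nz less])
       (use subdeg in \<open>auto simp: G_def\<close>)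
  moreover have "of_real (bernoulli_number j) * t ^ j / fact j = fps_nth F j * t ^ j" for j
    by (simp add: bernoulli_number_def F_def R_def)
  ultimately show ?thesis
    by (simp only: eval_G eval_fps_X)
qed

definition glaisher_p :: "nat \<Rightarrow> nat \<Rightarrow> real" where
  "glaisher_p n k =
     real n ^ k * ln (real n) / 2
     + real n ^ (k + 1) / real (k + 1) * (ln (real n) - 1 / real (k + 1))
     + fact k * (\<Sum>m = 1..k. real n ^ (k - m) * bernoulli_number (m + 1)
                               / (fact (m + 1) * fact (k - m))
         * (ln (real n) + (1 - (if k = m then 1 else 0)) * (\<Sum>l = 1..m. 1 / real (k - l + 1))))"

text \<open>The exponential makes \<open>glaisher k\<close> the positive number whose logarithm is the limit.\<close>

definition glaisher :: "nat \<Rightarrow> real" where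
  "glaisher k = exp (lim (\<lambda>n. (\<Sum>m = 1..n. real m ^ k * ln (real m)) - glaisher_p n k))"

end

theory Submission
  imports Defs "HOL-Real_Asymp.Real_Asymp"
begin

text \<open>
  The proof computes one integral in two ways. By Cauchy's formula for repeated integration, the
  \<open>m\<close>-fold integral equals \<open>\<integral>\<^sub>0\<^sup>1 w t * ln (Gamma t) dt\<close> with
  \<open>w t = (1 - t) ^ (m - 1) / (m - 1)!\<close> (\<open>cauchy_repeated_integration\<close>), and this is the
  Riemann--Liouville integral at \<open>1\<close>.

  Let \<open>F k x = x ^ k / k! * (ln x - H\<^sub>k)\<close>, the \<open>k\<close>-fold primitive of the logarithm. The functional
  equation gives \<open>ln (Gamma t) = ln (Gamma (n + t)) - (\<Sum>j<n. ln (j + t))\<close>. Integrating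
  \<open>w t * ln (j + t)\<close> is Taylor's formula for \<open>F m\<close> between \<open>j\<close> and \<open>j + 1\<close>
  (\<open>has_integral_taylor_kernel_ln\<close>), so it produces the values \<open>F k j\<close> for \<open>k \<le> m\<close>; log-convexity
  of \<open>Gamma\<close> gives \<open>ln (Gamma (n + t)) = ln (Gamma n) + t * ln n + o(1)\<close>
  (\<open>ln_Gamma_asymptotics\<close>).

  On the other side, the subtracted term \<open>glaisher_p n k\<close> is exactly \<open>k!\<close> times the Euler--Maclaurin
  expression \<open>P k n = (\<Sum>j\<le>k+1. B\<^sub>j / j! * F (k + 1 - j) n)\<close>, up to the term \<open>n ^ k * ln n\<close> and
  \<open>k! * H\<^sub>k\<close> times Bernoulli's formula for \<open>\<Sum>i<n. i ^ k / k!\<close>. Omitting the constant harmonic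
  contribution when the two indices agree is what makes this exact, because Bernoulli's formula has no
  constant term. Hence \<open>ln (glaisher k) / k!\<close> is the limit of \<open>(\<Sum>j<n. F k j) - P k n\<close>
  (\<open>euler_maclaurin_error_limit\<close>).

  The two sides match for every \<open>n\<close>, not only in the limit. With the generating function \<open>B\<close> of
  \<open>B\<^sub>j / j!\<close>, the identity \<open>B * (exp - 1) = X\<close> yields
  \<open>(\<Sum>k<m. P k n / (m - k)!) = F m n - ln n / (m + 1)!\<close>
  (\<open>sum_bernoulli_coeff_convolution\<close>), which cancels all the growing terms in
  \<open>taylor_kernel_ln_Gamma_shift\<close> and leaves an \<open>o(1)\<close> error.
\<close>

section \<open>Iterated primitives of the logarithm and Taylor's formula\<close>

text \<open>This is the \<open>k\<close>-fold primitive of \<open>ln\<close> for which all constants of integration are \<open>0\<close>; the harmonic number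
  absorbs the derivative of \<open>ln x\<close> in the product rule.\<close>

definition log_primitive :: "nat \<Rightarrow> real \<Rightarrow> real" where
  "log_primitive k x = x ^ k / fact k * (ln x - harm k)"

lemma log_primitive_0: "log_primitive 0 x = ln x"
  by (simp add: log_primitive_def harm_def)

text \<open>For \<open>k = 0\<close> this is the convention \<open>ln 0 = 0\<close>, and otherwise also the limit at \<open>0\<close>; so sums over
  \<open>0 < j < n\<close> may be written as sums over \<open>j < n\<close>.\<close>

lemma log_primitive_at_0: "log_primitive k 0 = 0"
  by (cases k) (simp_all add: log_primitive_def harm_def)

lemma log_primitive_deriv:
  assumes "x > 0"
  shows "(log_primitive (Suc k) has_real_derivative log_primitive k x) (at x)"
proof -
  have "((\<lambda>x. x ^ Suc k / fact (Suc k) * (ln x - harm (Suc k))) has_real_derivative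
      (real (Suc k) * x ^ k / fact (Suc k) * (ln x - harm (Suc k)) + x ^ Suc k / fact (Suc k) * (1 / x))) (at x)"
    using assms by (auto intro!: derivative_eq_intros simp del: power_Suc of_nat_Suc fact_Suc
        simp: add_divide_distrib)
  also have "real (Suc k) * x ^ k / fact (Suc k) * (ln x - harm (Suc k)) + x ^ Suc k / fact (Suc k) * (1 / x)
      = log_primitive k x"
    using assms unfolding log_primitive_def
    by (simp add: harm_Suc divide_simps del: of_nat_Suc) (simp add: algebra_simps)
  finally show ?thesis
    by (simp add: log_primitive_def[abs_def])
qed

text \<open>The factor \<open>x * ln x\<close> removes the singularity at \<open>0\<close>, so from index \<open>1\<close> on the primitives can be
  used as boundary values at \<open>0\<close>.\<close>

lemma log_primitive_continuous: "continuous_on {0..} (log_primitive (Suc k))"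
proof -
  have "continuous (at x within {0..}) (\<lambda>x::real. x * ln x)" if "x \<ge> 0" for x
  proof (cases "x = 0")
    case True
    have "((\<lambda>x::real. x * ln x) \<longlongrightarrow> 0) (at_right 0)"
      by real_asymp
    moreover have "at 0 within {0..} = at_right (0::real)"
      by (rule at_within_nhd[where S = UNIV]) auto
    ultimately show ?thesis
      using True by (simp add: continuous_within)
  next
    case False
    then show ?thesis using that by (auto intro!: continuous_intros)
  qed
  then have "continuous_on {0..} (\<lambda>x::real. x * ln x)"
    by (simp add: continuous_on_eq_continuous_within)
  then have "continuous_on {0..} (\<lambda>x::real. x ^ k * (x * ln x) / fact (Suc k) - x ^ Suc k / fact (Suc k) * harm (Suc k))"
    by (intro continuous_on_diff continuous_on_divide continuous_on_const
        continuous_on_mult[of _ "\<lambda>x. x ^ _"] continuous_on_mult[of _ "\<lambda>x. x ^ _ / _"]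
        continuous_on_power continuous_on_id) auto
  then show ?thesis
    by (rule continuous_on_eq) (simp add: log_primitive_def algebra_simps diff_divide_distrib)
qed

text \<open>This is at once the kernel of the integral remainder in Taylor's formula and the Riemann--Liouville
  kernel of order \<open>r + 1\<close> at the end point \<open>1\<close>, including its normalization \<open>1 / Gamma (r + 1)\<close>.\<close>

definition taylor_kernel :: "nat \<Rightarrow> real \<Rightarrow> real" where
  "taylor_kernel r t = (1 - t) ^ r / fact r"

lemma taylor_kernel_deriv:
  "(taylor_kernel (Suc r) has_real_derivative - taylor_kernel r t) (at t within S)"
  unfolding taylor_kernel_def[abs_def]
  by (rule derivative_eq_intros refl | simp add: divide_simps del: of_nat_Suc)+

lemma taylor_kernel_continuous [continuous_intros]: "continuous_on S (taylor_kernel r)"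
  unfolding taylor_kernel_def[abs_def] by (intro continuous_intros) auto

lemma taylor_kernel_bounds:
  assumes "t \<in> {0..1}"
  shows "0 \<le> taylor_kernel r t" "taylor_kernel r t \<le> 1"
proof -
  have "(1 - t) ^ r \<le> 1" using assms by (intro power_le_one) auto
  also have "(1::real) \<le> fact r" by (rule fact_ge_1)
  finally show "taylor_kernel r t \<le> 1"
    unfolding taylor_kernel_def by simp
qed (use assms in \<open>simp add: taylor_kernel_def\<close>)

lemma taylor_kernel_at_1: "taylor_kernel (Suc r) 1 = 0"
  by (simp add: taylor_kernel_def)

lemma taylor_kernel_at_0: "taylor_kernel r 0 = 1 / fact r"
  by (simp add: taylor_kernel_def)

lemma has_integral_taylor_kernel: "(taylor_kernel r has_integral 1 / fact (Suc r)) {0..1}"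
proof -
  have "((\<lambda>t. taylor_kernel r t) has_integral (- taylor_kernel (Suc r) 1 - (- taylor_kernel (Suc r) 0))) {0..1}"
    by (rule fundamental_theorem_of_calculus)
       (auto intro!: derivative_eq_intros taylor_kernel_deriv simp flip: has_real_derivative_iff_has_vector_derivative)
  then show ?thesis by (simp only: taylor_kernel_at_1 taylor_kernel_at_0) simp
qed

lemma has_integral_taylor_kernel_ident:
  "((\<lambda>t. taylor_kernel r t * t) has_integral 1 / fact (Suc (Suc r))) {0..1}"
proof -
  let ?P = "\<lambda>t. - taylor_kernel (Suc r) t * t - taylor_kernel (Suc (Suc r)) t"
  have "((\<lambda>t. taylor_kernel r t * t) has_integral (?P 1 - ?P 0)) {0..1}"
    by (rule fundamental_theorem_of_calculus)
       (auto intro!: derivative_eq_intros taylor_kernel_deriv simp flip: has_real_derivative_iff_has_vector_derivative)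
  then show ?thesis by (simp only: taylor_kernel_at_1 taylor_kernel_at_0) simp
qed

lemma log_primitive_shift_deriv:
  assumes "x + t > 0"
  shows "((\<lambda>t. log_primitive (Suc k) (x + t)) has_real_derivative log_primitive k (x + t)) (at t)"
proof -
  have "((\<lambda>t. x + t) has_real_derivative 1) (at t)"
    by (auto intro!: derivative_eq_intros)
  from DERIV_chain2[OF log_primitive_deriv[OF assms] this] show ?thesis
    by simp
qed

text \<open>The sum is the Taylor polynomial at the base point \<open>x + t\<close>, evaluated at \<open>x + 1\<close>. When the base point
  moves, the derivatives of consecutive terms telescope and only the last one survives.\<close>

lemma taylor_sum_deriv:
  assumes "x + t > 0" "r < N"
  shows "((\<lambda>t. \<Sum>i\<le>r. taylor_kernel i t * log_primitive (N - i) (x + t)) has_real_derivative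
           taylor_kernel r t * log_primitive (N - Suc r) (x + t)) (at t)"
  using assms(2)
proof (induction r)
  case (Suc r)
  have N: "N - Suc r = Suc (N - Suc (Suc r))" using Suc.prems by simp
  have "((\<lambda>t. taylor_kernel (Suc r) t * log_primitive (N - Suc r) (x + t)) has_real_derivative
      (- taylor_kernel r t * log_primitive (N - Suc r) (x + t)
       + log_primitive (N - Suc (Suc r)) (x + t) * taylor_kernel (Suc r) t)) (at t)"
    unfolding N by (rule DERIV_mult' [OF taylor_kernel_deriv log_primitive_shift_deriv[OF assms(1)], THEN DERIV_cong]) (simp add: algebra_simps)
  from DERIV_add[OF Suc.IH this] Suc.prems show ?case
    by (simp add: algebra_simps)
next
  case 0
  have N: "N = Suc (N - 1)" using 0 by simp
  have "((\<lambda>t. log_primitive N (x + t)) has_real_derivative log_primitive (N - 1) (x + t)) (at t)"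
    using log_primitive_shift_deriv[OF assms(1), of "N - 1"] N by simp
  then show ?case by (simp add: taylor_kernel_def)
qed

text \<open>Taylor's formula with integral remainder for \<open>log_primitive (Suc r)\<close> between \<open>x\<close> and \<open>x + 1\<close>.
  The case \<open>x = 0\<close>, where the integrand is singular, rests on the continuity of the primitives at \<open>0\<close>. The
  summand \<open>s = 0\<close> belongs to the Taylor polynomial of the next order; it is subtracted and added back so that
  the sum has the same shape for every \<open>r\<close>, namely a coefficient of a product with \<open>exp - 1\<close>.\<close>

lemma has_integral_taylor_kernel_ln:
  assumes "x \<ge> 0"
  shows "((\<lambda>t. taylor_kernel r t * ln (x + t)) has_integral
           log_primitive (Suc r) (x + 1) - log_primitive (Suc r) x
             - (\<Sum>s\<le>r. log_primitive s x / fact (Suc r - s)) + ln x / fact (Suc r)) {0..1}"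
proof -
  let ?H = "\<lambda>t. \<Sum>i\<le>r. taylor_kernel i t * log_primitive (Suc r - i) (x + t)"
  have "continuous_on {0..1} (\<lambda>t. log_primitive (Suc k) (x + t))" for k
    using assms by (intro continuous_on_compose2[OF log_primitive_continuous]) (auto intro!: continuous_intros)
  moreover have "Suc r - i = Suc (r - i)" if "i \<le> r" for i
    using that by simp
  ultimately have cont: "continuous_on {0..1} ?H"
    by (intro continuous_on_sum continuous_on_mult taylor_kernel_continuous) simp
  have "(?H has_real_derivative taylor_kernel r t * log_primitive 0 (x + t)) (at t)" if "t \<in> {0<..<1}" for t
    using taylor_sum_deriv[of x t r "Suc r"] assms that by simp
  then have int: "((\<lambda>t. taylor_kernel r t * log_primitive 0 (x + t)) has_integral (?H 1 - ?H 0)) {0..1}"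
    by (intro fundamental_theorem_of_calculus_interior cont)
       (simp_all flip: has_real_derivative_iff_has_vector_derivative)
  have "?H 1 = log_primitive (Suc r) (x + 1)"
    by (subst sum.remove[of _ 0]) (auto simp: taylor_kernel_def power_0_left intro!: sum.neutral)
  moreover have "?H 0 = (\<Sum>s\<le>r. log_primitive (Suc s) x / fact (r - s))"
    unfolding atMost_atLeast0 taylor_kernel_at_0
    by (subst sum.atLeastAtMost_rev) (auto intro!: sum.cong simp: Suc_diff_le)
  moreover have "\<dots> + log_primitive 0 x / fact (Suc r) = (\<Sum>s\<le>Suc r. log_primitive s x / fact (Suc r - s))"
    by (subst sum.atMost_Suc_shift) simp
  ultimately have "?H 1 - ?H 0 = log_primitive (Suc r) (x + 1) - log_primitive (Suc r) x
      - (\<Sum>s\<le>r. log_primitive s x / fact (Suc r - s)) + ln x / fact (Suc r)"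
    by (simp add: log_primitive_0)
  with int show ?thesis
    by (simp only: log_primitive_0)
qed

text \<open>Expand \<open>ln (x + t) = ln x + t / x + O(1 / x\<^sup>2)\<close> under the integral in Taylor's formula. The \<open>1 / x\<close>
  term is kept because it is not summable over \<open>x\<close>; it later disappears by a Bernoulli identity.\<close>

lemma log_primitive_taylor_remainder:
  assumes "x \<ge> 1"
  shows "\<bar>log_primitive i (x + 1) - log_primitive i x - (\<Sum>s<i. log_primitive s x / fact (i - s))
           - 1 / (x * fact (Suc i))\<bar> \<le> 1 / x\<^sup>2"
proof -
  have ln_bound: "\<bar>ln (x + t) - ln x - t / x\<bar> \<le> 1 / x\<^sup>2" if "t \<in> {0..1}" for t
  proof -
    have "x + t = x * (1 + t / x)"
      using assms by (simp add: field_simps)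
    then have "ln (x + t) = ln (x * (1 + t / x))"
      by (rule arg_cong)
    also have "\<dots> = ln x + ln (1 + t / x)"
      using assms that by (intro ln_mult_pos) (auto intro!: add_pos_nonneg)
    finally have "\<bar>ln (x + t) - ln x - t / x\<bar> = \<bar>ln (1 + t / x) - t / x\<bar>"
      by simp
    also have "\<dots> \<le> (t / x)\<^sup>2"
      using assms that by (intro abs_ln_one_plus_x_minus_x_bound_nonneg) auto
    also have "\<dots> \<le> (1 / x)\<^sup>2"
      using assms that by (intro power_mono divide_right_mono) auto
    finally show ?thesis
      by (simp add: power_divide)
  qed
  show ?thesis
  proof (cases i)
    case 0
    then show ?thesis
      using ln_bound[of 1] by (simp add: log_primitive_0)
  next
    case (Suc r)
    let ?f = "\<lambda>t. taylor_kernel r t * (ln (x + t) - ln x - t / x)"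
    let ?I = "log_primitive i (x + 1) - log_primitive i x - (\<Sum>s<i. log_primitive s x / fact (i - s))
                - 1 / (x * fact (Suc i))"
    have "((\<lambda>t. taylor_kernel r t * ln (x + t) - ln x * taylor_kernel r t - 1 / x * (taylor_kernel r t * t))
        has_integral ?I) {0..1}"
      using has_integral_diff[OF has_integral_diff[OF has_integral_taylor_kernel_ln[of x r]
            has_integral_mult_right[OF has_integral_taylor_kernel, of "ln x" r]]
          has_integral_mult_right[OF has_integral_taylor_kernel_ident, of "1 / x" r]] assms
      unfolding Suc lessThan_Suc_atMost by (simp del: fact_Suc)
    then have "(?f has_integral ?I) {0..1}"
      by (simp add: algebra_simps)
    moreover have "norm (?f t) \<le> 1 / x\<^sup>2" if "t \<in> {0..1}" for t
    proof -
      have "norm (?f t) = taylor_kernel r t * \<bar>ln (x + t) - ln x - t / x\<bar>"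
        using taylor_kernel_bounds[OF that, of r] by (simp add: abs_mult)
      also have "\<dots> \<le> 1 * (1 / x\<^sup>2)"
        using taylor_kernel_bounds[OF that, of r] ln_bound[OF that] by (intro mult_mono) auto
      finally show ?thesis by simp
    qed
    ultimately have "norm ?I \<le> 1 / x\<^sup>2 * measure lborel {0..1::real}"
      by (intro has_integral_bound_real[where f = ?f]) auto
    then show ?thesis by simp
  qed
qed

section \<open>Convolution identities for the Bernoulli numbers\<close>

definition bernoulli_coeff :: "nat \<Rightarrow> real" where
  "bernoulli_coeff j = bernoulli_number j / fact j"

text \<open>All Bernoulli identities below are coefficient comparisons after multiplying by this equation.\<close>

lemma bernoulli_fps: "Abs_fps bernoulli_coeff * (fps_exp 1 - 1) = fps_X"
proof -
  have sub: "subdegree (fps_exp 1 - 1 :: real fps) = 1"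
    by (rule subdegreeI) auto
  then have "(fps_exp 1 - 1 :: real fps) \<noteq> 0"
    by (metis subdegree_0 zero_neq_one)
  with sub have "(fps_exp 1 - 1 :: real fps) dvd fps_X"
    by (simp add: fps_dvd_iff)
  moreover have "Abs_fps bernoulli_coeff = fps_X / (fps_exp 1 - 1)"
    by (rule fps_ext) (simp add: bernoulli_coeff_def bernoulli_number_def)
  ultimately show ?thesis by simp
qed

lemma mult_fps_exp_minus_1_nth:
  "fps_nth (Abs_fps a * (fps_exp 1 - 1)) (Suc k) = (\<Sum>s\<le>k. a s / fact (Suc k - s))" for a :: "nat \<Rightarrow> real"
proof -
  have "fps_nth (Abs_fps a * (fps_exp 1 - 1)) (Suc k)
      = (\<Sum>s\<in>insert (Suc k) {..k}. a s * fps_nth (fps_exp 1 - 1) (Suc k - s))"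
    unfolding fps_mult_nth by (rule sum.cong) auto
  also have "\<dots> = (\<Sum>s\<le>k. a s * fps_nth (fps_exp 1 - 1) (Suc k - s))"
    by simp
  also have "\<dots> = (\<Sum>s\<le>k. a s / fact (Suc k - s))"
    by (rule sum.cong) auto
  finally show ?thesis .
qed

lemma sum_bernoulli_coeff:
  "(\<Sum>j\<le>r. bernoulli_coeff j / fact (Suc r - j)) = (if r = 0 then 1 else 0)"
  using mult_fps_exp_minus_1_nth[of bernoulli_coeff r] unfolding bernoulli_fps by simp

lemma bernoulli_coeff_0: "bernoulli_coeff 0 = 1"
  using sum_bernoulli_coeff[of 0] by simp

lemma bernoulli_coeff_1: "bernoulli_coeff 1 = - 1 / 2"
  using sum_bernoulli_coeff[of 1] by (simp add: bernoulli_coeff_0)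

text \<open>If \<open>d\<close> is obtained from \<open>a\<close> by the formal difference operator \<open>exp D - 1\<close>, then the Bernoulli
  combination inverts it up to one derivative: the generating function of \<open>d\<close> is that of \<open>a\<close> times
  \<open>exp - 1\<close>, and multiplying by \<open>X / (exp - 1)\<close> leaves a shift of \<open>a\<close>.\<close>

lemma sum_bernoulli_coeff_differences:
  fixes a d :: "nat \<Rightarrow> real"
  assumes "d 0 = 0" and "\<And>i. d (Suc i) = (\<Sum>s\<le>i. a s / fact (Suc i - s))"
  shows "(\<Sum>j\<le>Suc k. bernoulli_coeff j * d (Suc k - j)) = a k"
proof -
  have "Abs_fps d = Abs_fps a * (fps_exp 1 - 1)"
  proof (rule fps_ext)
    fix n show "fps_nth (Abs_fps d) n = fps_nth (Abs_fps a * (fps_exp 1 - 1)) n"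
      by (cases n) (simp_all add: assms mult_fps_exp_minus_1_nth)
  qed
  then have "Abs_fps bernoulli_coeff * Abs_fps d = fps_X * Abs_fps a"
    by (metis bernoulli_fps mult.assoc mult.commute)
  then have "fps_nth (Abs_fps bernoulli_coeff * Abs_fps d) (Suc k) = a k"
    by simp
  then show ?thesis
    by (simp only: fps_mult_nth atLeast0AtMost fps_nth_Abs_fps)
qed

text \<open>The same cancellation with the factors in the other order: first the Bernoulli combination, then the
  factor \<open>exp - 1\<close>. The full convolution would start at \<open>k = -1\<close>; that missing term is the
  correction \<open>a 0 / (m + 1)!\<close>.\<close>

lemma sum_bernoulli_coeff_convolution:
  fixes a :: "nat \<Rightarrow> real"
  shows "(\<Sum>k<m. (\<Sum>j\<le>Suc k. bernoulli_coeff j * a (Suc k - j)) / fact (m - k)) = a m - a 0 / fact (Suc m)"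
proof -
  define c where "c n = (\<Sum>j\<le>n. bernoulli_coeff j * a (n - j))" for n
  have "Abs_fps c = Abs_fps bernoulli_coeff * Abs_fps a"
    by (rule fps_ext) (simp add: c_def fps_mult_nth atLeast0AtMost)
  then have "Abs_fps c * (fps_exp 1 - 1) = fps_X * Abs_fps a"
    by (metis bernoulli_fps mult.assoc mult.commute)
  then have "(\<Sum>s\<le>m. c s / fact (Suc m - s)) = a m"
    using mult_fps_exp_minus_1_nth[of c m] by simp
  then show ?thesis
    unfolding c_def[symmetric]
    by (simp add: sum.atMost_shift c_def[of 0] bernoulli_coeff_0)
qed

section \<open>Euler--Maclaurin summation of the iterated primitives\<close>

text \<open>The Euler--Maclaurin formula for \<open>\<Sum>i<n. f i\<close> with \<open>f = log_primitive k\<close>, without constant and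
  remainder: \<open>log_primitive (Suc k - j)\<close> is the derivative of \<open>f\<close> of order \<open>j - 1\<close>, where order \<open>-1\<close>
  means the primitive.\<close>

definition euler_maclaurin_main :: "nat \<Rightarrow> real \<Rightarrow> real" where
  "euler_maclaurin_main k x = (\<Sum>j\<le>Suc k. bernoulli_coeff j * log_primitive (Suc k - j) x)"

text \<open>Inserting the Taylor expansions, the polynomial parts combine to \<open>log_primitive k x\<close>, and the
  \<open>1 / x\<close> parts carry the factor \<open>\<Sum>j\<le>k+1. B\<^sub>j / (j! * (k + 2 - j)!)\<close>, which vanishes.\<close>

lemma euler_maclaurin_main_diff:
  assumes "x \<ge> 1"
  shows "\<bar>euler_maclaurin_main k (x + 1) - euler_maclaurin_main k x - log_primitive k x\<bar>
           \<le> (\<Sum>j\<le>Suc k. \<bar>bernoulli_coeff j\<bar>) * (1 / x\<^sup>2)"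
proof -
  define d where "d i = (\<Sum>s<i. log_primitive s x / fact (i - s))" for i
  define e where "e i = log_primitive i (x + 1) - log_primitive i x - d i - 1 / (x * fact (Suc i))" for i
  have e: "\<bar>e i\<bar> \<le> 1 / x\<^sup>2" for i
    unfolding e_def d_def by (rule log_primitive_taylor_remainder[OF assms])
  have "(\<Sum>j\<le>Suc k. bernoulli_coeff j / fact (Suc (Suc k - j))) = (\<Sum>j\<le>Suc k. bernoulli_coeff j / fact (Suc (Suc k) - j))"
    by (intro sum.cong refl arg_cong2[where f = "(/)"] arg_cong[where f = fact]) auto
  then have zero: "(\<Sum>j\<le>Suc k. bernoulli_coeff j / fact (Suc (Suc k - j))) = 0"
    unfolding sum_bernoulli_coeff by simp
  have "euler_maclaurin_main k (x + 1) - euler_maclaurin_main k x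
      = (\<Sum>j\<le>Suc k. bernoulli_coeff j * (log_primitive (Suc k - j) (x + 1) - log_primitive (Suc k - j) x))"
    unfolding euler_maclaurin_main_def by (simp add: sum_subtractf right_diff_distrib del: sum.atMost_Suc)
  also have "\<dots> = (\<Sum>j\<le>Suc k. bernoulli_coeff j * d (Suc k - j)
      + 1 / x * (bernoulli_coeff j / fact (Suc (Suc k - j))) + bernoulli_coeff j * e (Suc k - j))"
  proof (rule sum.cong)
    fix j assume "j \<in> {..Suc k}"
    have "log_primitive (Suc k - j) (x + 1) - log_primitive (Suc k - j) x
        = d (Suc k - j) + 1 / (x * fact (Suc (Suc k - j))) + e (Suc k - j)"
      by (simp add: e_def)
    then show "bernoulli_coeff j * (log_primitive (Suc k - j) (x + 1) - log_primitive (Suc k - j) x)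
        = bernoulli_coeff j * d (Suc k - j)
          + 1 / x * (bernoulli_coeff j / fact (Suc (Suc k - j))) + bernoulli_coeff j * e (Suc k - j)"
      by (simp add: algebra_simps del: fact_Suc)
  qed simp
  also have "\<dots> = log_primitive k x + (\<Sum>j\<le>Suc k. bernoulli_coeff j * e (Suc k - j))"
  proof -
    have "(\<Sum>j\<le>Suc k. bernoulli_coeff j * d (Suc k - j)) = log_primitive k x"
      by (rule sum_bernoulli_coeff_differences) (simp_all add: d_def lessThan_Suc_atMost del: fact_Suc sum.lessThan_Suc)
    then show ?thesis
      unfolding sum.distrib sum_distrib_left[symmetric] zero by simp
  qed
  finally have "\<bar>euler_maclaurin_main k (x + 1) - euler_maclaurin_main k x - log_primitive k x\<bar>
      = \<bar>\<Sum>j\<le>Suc k. bernoulli_coeff j * e (Suc k - j)\<bar>"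
    by simp
  also have "\<dots> \<le> (\<Sum>j\<le>Suc k. \<bar>bernoulli_coeff j\<bar> * (1 / x\<^sup>2))"
    by (rule sum_abs[THEN order_trans], rule sum_mono) (simp only: abs_mult mult_left_mono[OF e abs_ge_zero])
  finally show ?thesis
    by (simp only: sum_distrib_right)
qed

definition euler_maclaurin_error :: "nat \<Rightarrow> nat \<Rightarrow> real" where
  "euler_maclaurin_error k n = (\<Sum>i<n. log_primitive k (real i)) - euler_maclaurin_main k (real n)"

text \<open>Consecutive errors differ by \<open>O(1 / n\<^sup>2)\<close>, so the telescoping series converges.\<close>

lemma euler_maclaurin_error_convergent: "convergent (euler_maclaurin_error k)"
proof -
  let ?U = "euler_maclaurin_error k" and ?M = "\<Sum>j\<le>Suc k. \<bar>bernoulli_coeff j\<bar>"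
  have "summable (\<lambda>n. ?U (Suc n) - ?U n)"
  proof (rule summable_comparison_test')
    show "summable (\<lambda>n. ?M * (1 / (real n)\<^sup>2))"
      using inverse_power_summable[of 2, where 'a = real]
      by (intro summable_mult) (simp add: field_simps)
    show "norm (?U (Suc n) - ?U n) \<le> ?M * (1 / (real n)\<^sup>2)" if "n \<ge> 1" for n
    proof -
      have "norm (?U (Suc n) - ?U n)
          = \<bar>euler_maclaurin_main k (real n + 1) - euler_maclaurin_main k (real n) - log_primitive k (real n)\<bar>"
        unfolding euler_maclaurin_error_def by (simp add: add.commute)
      also have "\<dots> \<le> ?M * (1 / (real n)\<^sup>2)"
        using that by (intro euler_maclaurin_main_diff) simp
      finally show ?thesis .
    qed
  qed
  then have "convergent (\<lambda>n. \<Sum>i<n. ?U (Suc i) - ?U i)"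
    by (simp only: summable_iff_convergent)
  then have "convergent (\<lambda>n. ?U n - ?U 0)"
    by (simp only: sum_lessThan_telescope)
  then show ?thesis
    by (simp add: convergent_diff_const_right_iff)
qed

section \<open>The generalized Glaisher constants as Euler--Maclaurin constants\<close>

text \<open>The constant case is set to \<open>0\<close> so that every function vanishes at \<open>x = 0\<close>, as a sum over \<open>i < n\<close>
  does at \<open>n = 0\<close>; this encodes that Bernoulli's formula has no constant term.\<close>

definition divided_power :: "nat \<Rightarrow> real \<Rightarrow> real" where
  "divided_power i x = (if i = 0 then 0 else x ^ i / fact i)"

lemma divided_power_diff:
  "divided_power (Suc i) (x + 1) - divided_power (Suc i) x = (\<Sum>s\<le>i. x ^ s / fact s / fact (Suc i - s))"
proof -
  have "(x + 1) ^ Suc i = (\<Sum>s\<le>Suc i. real (Suc i choose s) * x ^ s)"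
    by (subst binomial_ring) simp
  also have "\<dots> = (\<Sum>s\<le>Suc i. fact (Suc i) * (x ^ s / fact s / fact (Suc i - s)))"
    by (intro sum.cong) (simp_all add: binomial_fact del: fact_Suc)
  finally have "(x + 1) ^ Suc i / fact (Suc i) = (\<Sum>s\<le>Suc i. x ^ s / fact s / fact (Suc i - s))"
    by (simp add: sum_divide_distrib del: fact_Suc sum.atMost_Suc power_Suc)
  then show ?thesis
    by (simp add: divided_power_def del: power_Suc fact_Suc)
qed

text \<open>Bernoulli's formula for power sums: both sides vanish at \<open>0\<close> and have the same differences.\<close>

lemma sum_powers_bernoulli:
  "(\<Sum>i<n. real i ^ k / fact k) = (\<Sum>j\<le>Suc k. bernoulli_coeff j * divided_power (Suc k - j) (real n))"
proof (induction n)
  case 0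
  show ?case by (intro sum.neutral[symmetric, THEN trans[rotated]]) (auto simp: divided_power_def)
next
  case (Suc n)
  have "(\<Sum>j\<le>Suc k. bernoulli_coeff j * (divided_power (Suc k - j) (real n + 1) - divided_power (Suc k - j) (real n)))
      = real n ^ k / fact k"
    by (rule sum_bernoulli_coeff_differences) (rule divided_power_diff | simp add: divided_power_def)+
  then have "(\<Sum>j\<le>Suc k. bernoulli_coeff j * divided_power (Suc k - j) (real (Suc n)))
      = (\<Sum>j\<le>Suc k. bernoulli_coeff j * divided_power (Suc k - j) (real n)) + real n ^ k / fact k"
    unfolding right_diff_distrib sum_subtractf by (simp add: add.commute del: sum.atMost_Suc)
  then show ?case
    unfolding Suc.IH[symmetric] by simp
qed

lemma harm_diff:
  assumes "m \<le> k"
  shows "(\<Sum>l = 1..m. 1 / real (k - l + 1)) = harm k - harm (k - m)"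
  using assms
proof (induction m)
  case (Suc m)
  then have "harm (k - m) = harm (k - Suc m) + 1 / real (k - m)"
    using harm_Suc[of "k - Suc m", where 'a = real] by (simp add: Suc_diff_Suc inverse_eq_divide)
  moreover have "k - Suc m + 1 = k - m" using Suc.prems by simp
  ultimately show ?case using Suc by simp
qed simp

text \<open>The terms of \<open>glaisher_p\<close> are the Euler--Maclaurin terms of \<open>x ^ k * ln x\<close>, whose derivative of order
  \<open>m\<close> is \<open>k! / (k - m)! * x ^ (k - m) * (ln x + harm k - harm (k - m))\<close>. Writing the logarithmic part
  through \<open>log_primitive\<close>, whose own harmonic number is \<open>harm (k - m)\<close>, leaves \<open>harm k\<close> times powers,
  except for \<open>m = k\<close>, where the constant has been dropped. The term \<open>n ^ k * ln n\<close> comes from the sign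
  of \<open>B\<^sub>1\<close>: the defining sum includes its upper end point, Euler--Maclaurin with \<open>B\<^sub>1 = -1/2\<close> does not.\<close>

lemma glaisher_p_eq:
  "glaisher_p n k = real n ^ k * ln (real n) + fact k * (\<Sum>j\<le>Suc k. bernoulli_coeff j *
     (log_primitive (Suc k - j) (real n) + harm k * divided_power (Suc k - j) (real n)))"
proof -
  let ?g = "\<lambda>j. bernoulli_coeff j *
     (log_primitive (Suc k - j) (real n) + harm k * divided_power (Suc k - j) (real n))"
  have "(\<Sum>j\<le>Suc k. ?g j) = ?g 0 + (\<Sum>j\<le>k. ?g (Suc j))"
    by (rule sum.atMost_Suc_shift)
  also have "(\<Sum>j\<le>k. ?g (Suc j)) = ?g 1 + (\<Sum>j=1..k. ?g (Suc j))"
    by (simp add: sum.atMost_shift sum.shift_bounds_Suc_ivl atLeast1_atMost_eq_remove0 atMost_atLeast0 sum.atLeast_Suc_atMost)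
  finally have split: "(\<Sum>j\<le>Suc k. ?g j) = ?g 0 + ?g 1 + (\<Sum>m=1..k. ?g (m + 1))"
    by simp
  have g0: "fact k * ?g 0 = real n ^ (k + 1) / real (k + 1) * (ln (real n) - 1 / real (k + 1))"
    by (simp add: bernoulli_coeff_0 log_primitive_def divided_power_def harm_Suc inverse_eq_divide divide_simps
          del: power_Suc of_nat_Suc) (simp add: algebra_simps)
  have g1: "fact k * ?g 1 = - (real n ^ k * ln (real n) / 2)"
  proof (cases "k = 0")
    case True
    then show ?thesis
      by (simp add: bernoulli_coeff_1[simplified] log_primitive_0 harm_def)
  next
    case False
    have "fact k * ?g 1 = - 1 / 2 * (real n ^ k * (ln (real n) - harm k) + harm k * real n ^ k)"
      using False unfolding bernoulli_coeff_1 by (simp add: log_primitive_def divided_power_def field_simps)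
    then show ?thesis
      by (simp add: algebra_simps)
  qed
  have "?g (m + 1) = real n ^ (k - m) * bernoulli_number (m + 1) / (fact (m + 1) * fact (k - m))
         * (ln (real n) + (1 - (if k = m then 1 else 0)) * (\<Sum>l = 1..m. 1 / real (k - l + 1)))"
    if "m \<in> {1..k}" for m
  proof (cases "m = k")
    case True
    then show ?thesis
      by (simp add: log_primitive_0 divided_power_def bernoulli_coeff_def)
  next
    case False
    with that have "m \<le> k" "k - m \<noteq> 0" by auto
    then show ?thesis
      using False unfolding harm_diff[OF \<open>m \<le> k\<close>]
      by (simp add: log_primitive_def divided_power_def bernoulli_coeff_def algebra_simps add_divide_distrib diff_divide_distrib
            del: fact_Suc)
  qed
  then show ?thesis
    unfolding glaisher_p_def split distrib_left[of "fact k"] g0 g1 by simp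
qed

text \<open>Since \<open>x ^ k * ln x = k! * log_primitive k x + harm k * x ^ k\<close>, the power sums cancel by Bernoulli's
  formula and no limit is involved.\<close>

lemma glaisher_sequence_eq:
  "(\<Sum>m = 1..n. real m ^ k * ln (real m)) - glaisher_p n k = fact k * euler_maclaurin_error k n"
proof -
  have summand: "real i ^ k * ln (real i) = fact k * (log_primitive k (real i) + harm k * (real i ^ k / fact k))" for i
    by (simp add: log_primitive_def algebra_simps diff_divide_distrib)
  have "(\<Sum>m = 1..n. real m ^ k * ln (real m)) = (\<Sum>m\<le>n. real m ^ k * ln (real m))"
    by (simp add: sum.atMost_shift sum.atLeast1_atMost_eq)
  also have "\<dots> = (\<Sum>i<n. real i ^ k * ln (real i)) + real n ^ k * ln (real n)"
    by (simp flip: lessThan_Suc_atMost)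
  also have "(\<Sum>i<n. real i ^ k * ln (real i))
      = fact k * ((\<Sum>i<n. log_primitive k (real i)) + harm k * (\<Sum>i<n. real i ^ k / fact k))"
    unfolding summand by (simp add: sum.distrib sum_distrib_left distrib_left)
  finally show ?thesis
    unfolding glaisher_p_eq sum_powers_bernoulli euler_maclaurin_error_def euler_maclaurin_main_def
    by (simp add: sum.distrib sum_distrib_left algebra_simps del: sum.atMost_Suc)
qed

lemma euler_maclaurin_error_limit: "euler_maclaurin_error k \<longlonglongrightarrow> ln (glaisher k) / fact k"
proof -
  obtain c where c: "euler_maclaurin_error k \<longlonglongrightarrow> c"
    using euler_maclaurin_error_convergent convergent_def by blast
  then have "(\<lambda>n. fact k * euler_maclaurin_error k n) \<longlonglongrightarrow> fact k * c"
    by (intro tendsto_intros)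
  then have "lim (\<lambda>n. fact k * euler_maclaurin_error k n) = fact k * c"
    by (rule limI)
  then have "ln (glaisher k) = fact k * c"
    unfolding glaisher_def glaisher_sequence_eq by simp
  with c show ?thesis by simp
qed

section \<open>Cauchy's formula for repeated integration\<close>

lemma iterated_integral_Suc:
  "iterated_integral a (Suc j) f = (\<lambda>x. integral {a..x} (iterated_integral a j f))"
  by (rule ext) simp

lemma iterated_integral_continuous:
  assumes "f integrable_on {0..1}"
  shows "continuous_on {0..1} (iterated_integral 0 (Suc j) f)"
proof (induction j)
  case 0
  show ?case
    using indefinite_integral_continuous_1[OF assms] by simp
next
  case (Suc j)
  have "iterated_integral 0 (Suc j) f integrable_on {0..1}"
    using Suc by (rule integrable_continuous_real)
  from indefinite_integral_continuous_1[OF this] show ?case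
    unfolding iterated_integral_Suc[of 0 "Suc j"] .
qed

lemma iterated_integral_integrable:
  assumes "f integrable_on {0..1}"
  shows "iterated_integral 0 j f integrable_on {0..1}"
proof (cases j)
  case 0
  have "iterated_integral 0 0 f = f" by (rule ext) simp
  with 0 assms show ?thesis by simp
next
  case (Suc i)
  show ?thesis unfolding Suc by (rule integrable_continuous_real[OF iterated_integral_continuous[OF assms]])
qed

lemma iterated_integral_deriv:
  assumes f: "f integrable_on {0..1}" "continuous_on {0<..<1} f" and t: "t \<in> {0<..<1}"
  shows "(iterated_integral 0 (Suc j) f has_vector_derivative iterated_integral 0 j f t) (at t)"
proof -
  have "continuous_on {0<..<1} (iterated_integral 0 j f)"
  proof (cases j)
    case 0
    have "iterated_integral 0 0 f = f" by (rule ext) simp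
    with 0 f show ?thesis by simp
  next
    case (Suc i)
    show ?thesis unfolding Suc
      by (rule continuous_on_subset[OF iterated_integral_continuous[OF f(1)]]) auto
  qed
  then have "isCont (iterated_integral 0 j f) t"
    using t by (simp add: continuous_on_eq_continuous_at)
  then have "continuous (at t within ({0..1} - {})) (iterated_integral 0 j f)"
    by (rule continuous_at_imp_continuous_at_within)
  with integral_has_vector_derivative_continuous_at[OF iterated_integral_integrable[OF f(1), of j], of t "{}"] t
  have "((\<lambda>u. integral {0..u} (iterated_integral 0 j f)) has_vector_derivative iterated_integral 0 j f t) (at t within {0..1})"
    by simp
  with t show ?thesis
    by (simp add: at_within_Icc_at iterated_integral_Suc)
qed

text \<open>Each integration by parts trades one degree of the kernel for one more integration. The boundary terms
  vanish because the kernel is \<open>0\<close> at \<open>1\<close> and the iterated integral is \<open>0\<close> at \<open>0\<close>. Continuity of \<open>f\<close> is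
  required in the open interval only, so that a singularity at \<open>0\<close> is allowed.\<close>

lemma cauchy_repeated_integration:
  assumes f: "f integrable_on {0..1}" "continuous_on {0<..<1} f"
  shows "((\<lambda>t. taylor_kernel r t * iterated_integral 0 j f t) has_integral iterated_integral 0 (Suc (r + j)) f 1) {0..1}"
proof (induction r arbitrary: j)
  case 0
  show ?case
    using integrable_integral[OF iterated_integral_integrable[OF f(1), of j]]
    by (simp add: taylor_kernel_def)
next
  case (Suc r)
  let ?A = "iterated_integral 0 (Suc j) f" and ?y = "iterated_integral 0 (Suc (Suc r + j)) f 1"
  have "?A 0 = 0" by simp
  have "((\<lambda>t. iterated_integral 0 j f t * taylor_kernel (Suc r) t) has_integral ?y) {0..1}"
  proof (rule integration_by_parts_interior[where prod = "(*)" and f = ?A and f' = "iterated_integral 0 j f" and g = "taylor_kernel (Suc r)" and g' = "\<lambda>t. - taylor_kernel r t"])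
    have "((\<lambda>t. - (taylor_kernel r t * ?A t)) has_integral - ?y) {0..1}"
      using has_integral_neg[OF Suc.IH[of "Suc j"]] by (simp del: iterated_integral.simps)
    then show "((\<lambda>t. ?A t * - taylor_kernel r t) has_integral
        (?A 1 * taylor_kernel (Suc r) 1 - ?A 0 * taylor_kernel (Suc r) 0 - ?y)) {0..1}"
      unfolding taylor_kernel_at_1 \<open>?A 0 = 0\<close> by (simp add: mult.commute del: iterated_integral.simps)
    show "(taylor_kernel (Suc r) has_vector_derivative - taylor_kernel r t) (at t)" for t
      using taylor_kernel_deriv by (simp flip: has_real_derivative_iff_has_vector_derivative)
  qed (auto intro!: iterated_integral_continuous iterated_integral_deriv f taylor_kernel_continuous
         bounded_bilinear_mult simp del: iterated_integral.simps)
  then show ?case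
    by (simp add: mult.commute del: iterated_integral.simps)
qed

section \<open>The logarithm of the Gamma function\<close>

text \<open>This includes \<open>x = 0\<close>, where \<open>Gamma 0 = 0\<close> and \<open>ln 0 = 0\<close> make both sides \<open>0\<close>; iterating it from
  there gives \<open>ln (Gamma n) = (\<Sum>j<n. ln j)\<close>.\<close>

lemma ln_Gamma_plus1:
  assumes "x \<ge> 0"
  shows "ln (Gamma (x + 1)) = ln (Gamma x) + ln (x::real)"
proof (cases "x = 0")
  case False
  with assms have "x \<notin> \<int>\<^sub>\<le>\<^sub>0" by (auto elim!: nonpos_Ints_cases)
  then show ?thesis
    using False assms by (simp add: Gamma_plus1 ln_mult_pos)
qed simp

lemma ln_Gamma_add_nat:
  assumes "x \<ge> 0"
  shows "ln (Gamma (real n + x)) = ln (Gamma x) + (\<Sum>j<n. ln (real j + x))"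
proof (induction n)
  case (Suc n)
  have "ln (Gamma (real n + x + 1)) = ln (Gamma (real n + x)) + ln (real n + x)"
    using assms by (intro ln_Gamma_plus1) simp
  with Suc show ?case
    by (simp add: add_ac)
qed simp

lemma isCont_ln_Gamma: "x > 0 \<Longrightarrow> isCont (\<lambda>x::real. ln (Gamma x)) x"
  by (intro continuous_intros) (auto simp: Gamma_eq_zero_iff elim!: nonpos_Ints_cases)

text \<open>The singularity at \<open>0\<close> is that of \<open>- ln t\<close>, which is nonnegative and integrable.\<close>

lemma ln_Gamma_absolutely_integrable:
  "(\<lambda>t::real. ln (Gamma t)) absolutely_integrable_on {0..1}"
proof -
  have "(\<lambda>t::real. ln t) integrable_on {0..1}"
    using has_integral_taylor_kernel_ln[of 0 0] by (auto simp: taylor_kernel_def integrable_on_def)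
  then have "(\<lambda>t::real. - ln t) absolutely_integrable_on {0..1}"
    by (intro nonnegative_absolutely_integrable_1 integrable_neg) (auto simp: ln_le_zero_iff le_less)
  moreover have "(\<lambda>t::real. ln (Gamma (t + 1))) absolutely_integrable_on {0..1}"
    by (intro absolutely_integrable_continuous_real continuous_at_imp_continuous_on ballI
         isCont_o2[OF _ isCont_ln_Gamma] continuous_intros) auto
  ultimately have sum: "(\<lambda>t::real. ln (Gamma (t + 1)) + - ln t) absolutely_integrable_on {0..1}"
    by (rule set_integral_add(1)[rotated])
  have "ln (Gamma (t + 1)) + - ln t = ln (Gamma t)" if "t \<in> {0..1}" for t :: real
    using ln_Gamma_plus1[of t] that by simp
  then show ?thesis
    by (intro absolutely_integrable_spike[OF sum negligible_empty]) simp
qed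

text \<open>By convexity the graph of \<open>ln \<circ> Gamma\<close> over \<open>[x, x + 1]\<close> lies below the chord, of slope \<open>ln x\<close>, and
  above the continuation of the chord over \<open>[x - 1, x]\<close>, of slope \<open>ln (x - 1)\<close>.\<close>

lemma ln_Gamma_asymptotics:
  fixes x t :: real
  assumes "x > 1" "t \<in> {0..1}"
  shows "\<bar>ln (Gamma (x + t)) - ln (Gamma x) - t * ln x\<bar> \<le> ln x - ln (x - 1)"
proof -
  let ?L = "\<lambda>x::real. ln (Gamma x)"
  have conv: "?L ((1 - u) * a + u * b) \<le> (1 - u) * ?L a + u * ?L b"
    if "a > 0" "b > 0" "u \<in> {0..1}" for a b u
    using convex_onD[OF log_convex_Gamma_real, of u a b] that by simp
  have up: "?L (x + 1) = ?L x + ln x" and down: "?L x = ?L (x - 1) + ln (x - 1)"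
    using ln_Gamma_plus1[of x] ln_Gamma_plus1[of "x - 1"] assms by auto
  have "?L ((1 - t) * x + t * (x + 1)) \<le> (1 - t) * ?L x + t * ?L (x + 1)"
    using assms by (intro conv) auto
  then have upper: "?L (x + t) - ?L x - t * ln x \<le> 0"
    unfolding up by (simp add: algebra_simps)
  \<comment> \<open>the weight that makes \<open>x\<close> the convex combination of \<open>x - 1\<close> and \<open>x + t\<close>\<close>
  define u where "u = 1 / (1 + t)"
  have inv: "u * (1 + t) = 1" "u \<in> {0..1}" using assms by (auto simp: u_def)
  have "(1 - u) * (x - 1) + u * (x + t) = x - 1 + u * (1 + t)"
    by (simp add: algebra_simps)
  then have x: "(1 - u) * (x - 1) + u * (x + t) = x"
    unfolding inv(1) by simp
  have "?L ((1 - u) * (x - 1) + u * (x + t)) \<le> (1 - u) * ?L (x - 1) + u * ?L (x + t)"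
    using assms inv(2) by (intro conv) auto
  then have "?L x * (1 + t) \<le> ((1 - u) * ?L (x - 1) + u * ?L (x + t)) * (1 + t)"
    unfolding x using assms by (intro mult_right_mono) auto
  also have "\<dots> = (1 + t - u * (1 + t)) * ?L (x - 1) + u * (1 + t) * ?L (x + t)"
    by (simp add: algebra_simps)
  finally have "t * ln (x - 1) \<le> ?L (x + t) - ?L x"
    unfolding inv(1) down by (simp add: algebra_simps)
  moreover have "t * (ln x - ln (x - 1)) \<le> 1 * (ln x - ln (x - 1))"
    using assms by (intro mult_right_mono) auto
  moreover have "ln (x - 1) \<le> ln x" using assms by simp
  ultimately show ?thesis
    using upper by (simp add: algebra_simps abs_le_iff)
qed

section \<open>The repeated integral in terms of Glaisher constants\<close>

text \<open>Subtracting \<open>ln (Gamma n) + t * ln n\<close> from \<open>ln (Gamma (n + t))\<close> makes the integrand small. On the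
  right the subtraction supplies the summand \<open>k = 0\<close>, as \<open>ln (Gamma n) = (\<Sum>j<n. ln j)\<close>, and the term
  \<open>ln n / (m + 1)!\<close> of the Bernoulli convolution, with \<open>m = Suc r\<close>.\<close>

lemma taylor_kernel_ln_Gamma_shift:
  assumes I: "((\<lambda>t. taylor_kernel r t * ln (Gamma t)) has_integral I) {0..1}"
  shows "((\<lambda>t. taylor_kernel r t * (ln (Gamma (real n + t)) - ln (Gamma (real n)) - t * ln (real n)))
           has_integral (I - (\<Sum>k\<le>r. euler_maclaurin_error k n / fact (Suc r - k)))) {0..1}"
proof -
  let ?F = log_primitive
  define T where "T j = ?F (Suc r) (real j + 1) - ?F (Suc r) (real j)
             - (\<Sum>s\<le>r. ?F s (real j) / fact (Suc r - s)) + ln (real j) / fact (Suc r)" for j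
  have combined: "((\<lambda>t. taylor_kernel r t * ln (Gamma t) + (\<Sum>j<n. taylor_kernel r t * ln (real j + t))
           - ln (Gamma (real n)) * taylor_kernel r t - ln (real n) * (taylor_kernel r t * t)) has_integral
         I + (\<Sum>j<n. T j) - ln (Gamma (real n)) * (1 / fact (Suc r)) - ln (real n) * (1 / fact (Suc (Suc r)))) {0..1}"
    unfolding T_def
    by (intro has_integral_diff has_integral_add I has_integral_sum has_integral_taylor_kernel_ln
          has_integral_mult_right has_integral_taylor_kernel has_integral_taylor_kernel_ident) auto
  have shift: "taylor_kernel r t * ln (Gamma t) + (\<Sum>j<n. taylor_kernel r t * ln (real j + t))
           - ln (Gamma (real n)) * taylor_kernel r t - ln (real n) * (taylor_kernel r t * t)
      = taylor_kernel r t * (ln (Gamma (real n + t)) - ln (Gamma (real n)) - t * ln (real n))"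
    if "t \<in> {0..1}" for t
    using ln_Gamma_add_nat[of t n] that by (simp add: sum_distrib_left algebra_simps)
  have total: "I + (\<Sum>j<n. T j) - ln (Gamma (real n)) * (1 / fact (Suc r)) - ln (real n) * (1 / fact (Suc (Suc r)))
      = I - (\<Sum>k\<le>r. euler_maclaurin_error k n / fact (Suc r - k))"
  proof -
    have "(\<Sum>j<n. ?F (Suc r) (real (Suc j)) - ?F (Suc r) (real j)) = ?F (Suc r) (real n)"
      by (subst sum_lessThan_telescope) (simp add: log_primitive_at_0)
    moreover have "(\<Sum>j<n. \<Sum>s\<le>r. ?F s (real j) / fact (Suc r - s))
        = (\<Sum>s\<le>r. (\<Sum>j<n. ?F s (real j)) / fact (Suc r - s))"
      by (subst sum.swap) (simp add: sum_divide_distrib)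
    moreover have "ln (Gamma (real n)) = (\<Sum>j<n. ln (real j))"
      using ln_Gamma_add_nat[of 0 n] by simp
    moreover have "(\<Sum>j<n. T j) = (\<Sum>j<n. ?F (Suc r) (real (Suc j)) - ?F (Suc r) (real j))
        - (\<Sum>j<n. \<Sum>s\<le>r. ?F s (real j) / fact (Suc r - s)) + (\<Sum>j<n. ln (real j)) / fact (Suc r)"
      unfolding sum_divide_distrib sum_subtractf[symmetric] sum.distrib[symmetric]
      by (rule sum.cong) (simp_all add: T_def add.commute)
    ultimately have T: "(\<Sum>j<n. T j) = ?F (Suc r) (real n)
        - (\<Sum>s\<le>r. (\<Sum>j<n. ?F s (real j)) / fact (Suc r - s)) + ln (Gamma (real n)) / fact (Suc r)"
      by (simp only:)
    have "(\<Sum>k\<le>r. euler_maclaurin_main k (real n) / fact (Suc r - k)) = ?F (Suc r) (real n) - ln (real n) / fact (Suc (Suc r))"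
      using sum_bernoulli_coeff_convolution[where m = "Suc r" and a = "\<lambda>i. ?F i (real n)"]
      unfolding euler_maclaurin_main_def lessThan_Suc_atMost by (simp only: log_primitive_0)
    then show ?thesis
      unfolding T euler_maclaurin_error_def by (simp add: sum_subtractf diff_divide_distrib del: fact_Suc)
  qed
  show ?thesis
    using combined unfolding total by (rule has_integral_eq[rotated]) (rule shift)
qed

text \<open>The preceding integrals tend to \<open>0\<close> as \<open>n\<close> grows, while their values tend to the difference of
  the two sides.\<close>

lemma taylor_kernel_ln_Gamma:
  assumes I: "((\<lambda>t. taylor_kernel r t * ln (Gamma t)) has_integral I) {0..1}"
  shows "I = (\<Sum>k\<le>r. ln (glaisher k) / (fact k * fact (Suc r - k)))"
proof -
  let ?V = "\<lambda>n. I - (\<Sum>k\<le>r. euler_maclaurin_error k n / fact (Suc r - k))"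
  have "norm (?V n) \<le> ln (real n) - ln (real n - 1)" if "n \<ge> 2" for n
  proof -
    let ?f = "\<lambda>t. taylor_kernel r t * (ln (Gamma (real n + t)) - ln (Gamma (real n)) - t * ln (real n))"
    have "norm (?f t) \<le> ln (real n) - ln (real n - 1)" if "t \<in> {0..1}" for t
    proof -
      have "norm (?f t) = taylor_kernel r t * \<bar>ln (Gamma (real n + t)) - ln (Gamma (real n)) - t * ln (real n)\<bar>"
        using taylor_kernel_bounds[OF that, of r] by (simp add: abs_mult)
      also have "\<dots> \<le> 1 * (ln (real n) - ln (real n - 1))"
        using taylor_kernel_bounds[OF that, of r] \<open>n \<ge> 2\<close> that
        by (intro mult_mono ln_Gamma_asymptotics) auto
      finally show ?thesis by simp
    qed
    moreover have "0 \<le> ln (real n) - ln (real n - 1)" using that by simp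
    ultimately have "norm (?V n) \<le> (ln (real n) - ln (real n - 1)) * measure lborel {0..1::real}"
      using taylor_kernel_ln_Gamma_shift[OF I, of n] by (intro has_integral_bound_real[where f = ?f]) auto
    then show ?thesis by simp
  qed
  then have "\<forall>\<^sub>F n in sequentially. norm (?V n) \<le> ln (real n) - ln (real n - 1)"
    by (auto simp: eventually_sequentially)
  moreover have "(\<lambda>n. ln (real n) - ln (real n - 1)) \<longlonglongrightarrow> 0"
    by real_asymp
  ultimately have "?V \<longlonglongrightarrow> 0"
    by (rule Lim_null_comparison)
  moreover have "?V \<longlonglongrightarrow> I - (\<Sum>k\<le>r. ln (glaisher k) / fact k / fact (Suc r - k))"
    by (intro tendsto_intros euler_maclaurin_error_limit) simp
  ultimately have "I - (\<Sum>k\<le>r. ln (glaisher k) / fact k / fact (Suc r - k)) = 0"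
    by (rule LIMSEQ_unique[symmetric])
  then show ?thesis by simp
qed

theorem corollary1p1:
  fixes m :: nat
  assumes "m \<ge> 1"
  shows "(\<lambda>t. complex_of_real (1 - t) powr (of_nat m - 1) * complex_of_real (ln (Gamma t)))
           absolutely_integrable_on {0..1}
       \<and> (\<forall>j<m. iterated_integral 0 j (\<lambda>t. ln (Gamma t)) absolutely_integrable_on {0..1})
       \<and> rl_integral 0 (of_nat m) (\<lambda>t. complex_of_real (ln (Gamma t))) 1
           = complex_of_real (iterated_integral 0 m (\<lambda>t. ln (Gamma t)) 1)
       \<and> iterated_integral 0 m (\<lambda>t. ln (Gamma t)) 1
           = 1 / fact m * (\<Sum>k = 0..m - 1. real (m choose k) * ln (glaisher k))
       \<and> 1 / fact m * (\<Sum>k = 0..m - 1. real (m choose k) * ln (glaisher k))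
           = (\<Sum>k = 0..m - 1. ln (glaisher k) / (fact k * fact (m - k)))"
proof -
  let ?f = "\<lambda>t::real. ln (Gamma t)"
  obtain r where m: "m = Suc r" using assms by (cases m) auto
  have abs: "?f absolutely_integrable_on {0..1}" by (rule ln_Gamma_absolutely_integrable)
  then have int: "?f integrable_on {0..1}" by (rule absolutely_integrable_on_def[THEN iffD1, THEN conjunct1])
  have cont: "continuous_on {0<..<1} ?f"
    by (intro continuous_at_imp_continuous_on ballI isCont_ln_Gamma) simp
  have I: "((\<lambda>t. taylor_kernel r t * ?f t) has_integral iterated_integral 0 m ?f 1) {0..1}"
    using cauchy_repeated_integration[OF int cont, of r 0] by (simp add: m)

  \<comment> \<open>At \<open>t = 1\<close> with \<open>m = 1\<close> the convention \<open>0 powr 0 = 0\<close> is harmless, since \<open>ln (Gamma 1) = 0\<close>.\<close>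
  have kernel: "complex_of_real (1 - t) powr (of_nat m - 1) * complex_of_real (?f t)
      = fact r * complex_of_real (taylor_kernel r t * ?f t)" if "t \<in> {0..1}" for t
  proof (cases "t = 1")
    case False
    then have "complex_of_real (1 - t) powr of_nat r = complex_of_real (1 - t) ^ r"
      by (intro powr_nat') simp
    then show ?thesis by (simp add: m taylor_kernel_def)
  qed (simp add: m)

  have "(\<lambda>t. taylor_kernel r t * ?f t) absolutely_integrable_on {0..1}"
  proof (rule absolutely_integrable_bounded_measurable_product_real[OF _ _ _ abs])
    show "taylor_kernel r \<in> borel_measurable (lebesgue_on {0..1})"
      by (intro continuous_imp_measurable_on_sets_lebesgue taylor_kernel_continuous) simp
    show "bounded (taylor_kernel r ` {0..1})"
      by (intro compact_imp_bounded compact_continuous_image taylor_kernel_continuous) simp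
  qed simp
  from absolutely_integrable_linear[OF this bounded_linear_const_mult[OF bounded_linear_of_real, of "fact r :: complex"]]
  have scaled: "(\<lambda>t. fact r * complex_of_real (taylor_kernel r t * ?f t)) absolutely_integrable_on {0..1}"
    by (simp only: o_def)
  have integrand: "(\<lambda>t. complex_of_real (1 - t) powr (of_nat m - 1) * complex_of_real (?f t)) absolutely_integrable_on {0..1}"
    using kernel by (intro absolutely_integrable_spike[OF scaled negligible_empty]) simp

  have inner: "iterated_integral 0 j ?f absolutely_integrable_on {0..1}" for j
  proof (cases j)
    case 0
    have "iterated_integral 0 0 ?f = ?f" by (rule ext) simp
    with 0 abs show ?thesis by simp
  next
    case (Suc i)
    show ?thesis unfolding Suc
      by (intro absolutely_integrable_continuous_real iterated_integral_continuous int)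
  qed

  have rl: "rl_integral 0 (of_nat m) (\<lambda>t. complex_of_real (?f t)) 1
      = complex_of_real (iterated_integral 0 m ?f 1)"
  proof -
    have "((\<lambda>t. fact r * complex_of_real (taylor_kernel r t * ?f t))
        has_integral (fact r * complex_of_real (iterated_integral 0 m ?f 1))) {0..1}"
      by (intro has_integral_mult_right has_integral_of_real I)
    then have "((\<lambda>t. complex_of_real (1 - t) powr (of_nat m - 1) * complex_of_real (?f t))
        has_integral (fact r * complex_of_real (iterated_integral 0 m ?f 1))) {0..1}"
      by (rule has_integral_eq[rotated]) (rule kernel[symmetric])
    then have "integral {0..1} (\<lambda>t. complex_of_real (1 - t) powr (of_nat m - 1) * complex_of_real (?f t))
        = fact r * complex_of_real (iterated_integral 0 m ?f 1)"
      by (rule integral_unique)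
    moreover have "Gamma (of_nat m :: complex) = fact r"
      unfolding m by (simp add: Gamma_fact add.commute)
    ultimately show ?thesis
      unfolding rl_integral_def by simp
  qed

  have binom: "1 / fact m * (\<Sum>k = 0..m - 1. real (m choose k) * ln (glaisher k))
      = (\<Sum>k = 0..m - 1. ln (glaisher k) / (fact k * fact (m - k)))"
    unfolding sum_distrib_left
  proof (rule sum.cong)
    fix k assume "k \<in> {0..m - 1}"
    then have "k \<le> m" by simp
    then show "1 / fact m * (real (m choose k) * ln (glaisher k)) = ln (glaisher k) / (fact k * fact (m - k))"
      by (simp add: binomial_fact)
  qed simp

  have "iterated_integral 0 m ?f 1 = (\<Sum>k = 0..m - 1. ln (glaisher k) / (fact k * fact (m - k)))"
    using taylor_kernel_ln_Gamma[OF I] unfolding m by (simp only: atMost_atLeast0 diff_Suc_1)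

  from this[folded binom] show ?thesis
    by (intro conjI allI impI integrand inner rl binom)
qed

end
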